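(* Let $S$ be an intra-regular $\Gamma$-AG$^{\ast\ast}$-groupoid. The set of all intuitionistic fuzzy $\Gamma$-two-sided ideals of $S$, with the operation $\circ_\Gamma$, forms a semilattice (i.e. it is closed under $\circ_\Gamma$, and $\circ_\Gamma$ is associative, commutative and idempotent on it) with identity $\delta=(S_\delta,\Theta_\delta)$.
   Context: Let $S,\Gamma$ be nonempty sets with a map $S\times\Gamma\times S\to S$, $(x,\alpha,y)\mapsto x\alpha y$. $S$ is a $\Gamma$-AG-groupoid if $(x\alpha y)\beta z=(z\alpha y)\beta x$ for all $x,y,z\in S$, $\alpha,\beta\in\Gamma$. It is a $\Gamma$-AG$^{\ast\ast}$-groupoid if moreover $x\alpha(y\beta z)=y\alpha(x\beta z)$ for all $x,y,z\in S$, $\alpha,\beta\in\Gamma$. $S$ is intra-regular if for every $a\in S$ there exist $x,y\in S$ and $\alpha,\beta,\gamma\in\Gamma$ with $a=(x\alpha(a\beta a))\gamma y$. An intuitionistic fuzzy set (IFS) of $S$ is a pair $A=(\mu_A,\gamma_A)$ of functions $\mu_A,\gamma_A:S\to[0,1]$ with $0\le\mu_A(x)+\gamma_A(x)\le1$ for all $x\in S$. Let $\delta=(S_\delta,\Theta_\delta)$ be the IFS with $S_\delta(x)=1$, $\Theta_\delta(x)=0$ for all $x$. The product $A\circ_\Gamma B=(\mu_A\circ_\Gamma\mu_B,\gamma_A\circ_\Gamma\gamma_B)$ is given by $(\mu_A\circ_\Gamma\mu_B)(a)=\sup\{\mu_A(b)\wedge\mu_B(c)\}$ and $(\gamma_A\circ_\Gamma\gamma_B)(a)=\inf\{\gamma_A(b)\vee\gamma_B(c)\}$,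 over all $b,c\in S$, $\beta\in\Gamma$ with $a=b\beta c$, if such a factorization exists, and by $0$ and $1$ respectively otherwise. Here $\wedge=\min$, $\vee=\max$. An IFS $A$ of $S$ is an intuitionistic fuzzy $\Gamma$-two-sided ideal if for all $x,y\in S$ and $\alpha\in\Gamma$: $\mu_A(x\alpha y)\ge\mu_A(y)$, $\gamma_A(x\alpha y)\le\gamma_A(y)$ (left ideal), and $\mu_A(x\alpha y)\ge\mu_A(x)$, $\gamma_A(x\alpha y)\le\gamma_A(x)$ (right ideal). *)

theory Defs
  imports Complex_Main "HOL-Library.FuncSet" "HOL-Algebra.Group"
begin

locale gamma_AG_groupoid =
  fixes S :: "'a set" and \<Gamma> :: "'g set" and m :: "'a \<Rightarrow> 'g \<Rightarrow> 'a \<Rightarrow> 'a"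
  assumes S_nonempty: "S \<noteq> {}"
    and Gamma_nonempty: "\<Gamma> \<noteq> {}"
    and m_mem: "\<lbrakk>x \<in> S; \<alpha> \<in> \<Gamma>; y \<in> S\<rbrakk> \<Longrightarrow> m x \<alpha> y \<in> S"
    and left_invertive: "\<lbrakk>x \<in> S; y \<in> S; z \<in> S; \<alpha> \<in> \<Gamma>; \<beta> \<in> \<Gamma>\<rbrakk>
           \<Longrightarrow> m (m x \<alpha> y) \<beta> z = m (m z \<alpha> y) \<beta> x"

locale gamma_AG_star_star_groupoid = gamma_AG_groupoid +
  assumes star_star: "\<lbrakk>x \<in> S; y \<in> S; z \<in> S; \<alpha> \<in> \<Gamma>; \<beta> \<in> \<Gamma>\<rbrakk>
           \<Longrightarrow> m x \<alpha> (m y \<beta> z) = m y \<alpha> (m x \<beta> z)"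

definition intra_regular :: "'a set \<Rightarrow> 'g set \<Rightarrow> ('a \<Rightarrow> 'g \<Rightarrow> 'a \<Rightarrow> 'a) \<Rightarrow> bool" where
  "intra_regular S \<Gamma> m \<longleftrightarrow>
     (\<forall>a\<in>S. \<exists>x\<in>S. \<exists>y\<in>S. \<exists>\<alpha>\<in>\<Gamma>. \<exists>\<beta>\<in>\<Gamma>. \<exists>\<gamma>\<in>\<Gamma>. a = m (m x \<alpha> (m a \<beta> a)) \<gamma> y)"

text \<open>Fuzzy sets on \<open>S\<close> are extensional functions (\<open>undefined\<close> outside \<open>S\<close>), so that
  equality of the HOL functions is equality of the functions \<open>S \<rightarrow> [0,1]\<close>.\<close>

type_synonym 'a ifs = "('a \<Rightarrow> real) \<times> ('a \<Rightarrow> real)"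

abbreviation membership :: "'a ifs \<Rightarrow> 'a \<Rightarrow> real" where "membership \<equiv> fst"
abbreviation nonmembership :: "'a ifs \<Rightarrow> 'a \<Rightarrow> real" where "nonmembership \<equiv> snd"

definition is_ifs :: "'a set \<Rightarrow> 'a ifs \<Rightarrow> bool" where
  "is_ifs S A \<longleftrightarrow>
     membership A \<in> S \<rightarrow>\<^sub>E {0..1} \<and> nonmembership A \<in> S \<rightarrow>\<^sub>E {0..1} \<and>
     (\<forall>x\<in>S. 0 \<le> membership A x + nonmembership A x \<and>
            membership A x + nonmembership A x \<le> 1)"

definition ifs_delta :: "'a set \<Rightarrow> 'a ifs" where
  "ifs_delta S = ((\<lambda>x\<in>S. 1), (\<lambda>x\<in>S. 0))"

definition factorizations ::
    "'a set \<Rightarrow> 'g set \<Rightarrow> ('a \<Rightarrow> 'g \<Rightarrow> 'a \<Rightarrow> 'a) \<Rightarrow> 'a \<Rightarrow> ('a \<times> 'a) set" where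
  "factorizations S \<Gamma> m a = {(b, c). b \<in> S \<and> c \<in> S \<and> (\<exists>\<beta>\<in>\<Gamma>. a = m b \<beta> c)}"

text \<open>The separate case for an empty set of factorizations is essential: \<open>Sup {}\<close> and
  \<open>Inf {}\<close> are not the required values \<open>0\<close> and \<open>1\<close> in \<^typ>\<open>real\<close>.\<close>

definition ifs_product ::
    "'a set \<Rightarrow> 'g set \<Rightarrow> ('a \<Rightarrow> 'g \<Rightarrow> 'a \<Rightarrow> 'a) \<Rightarrow> 'a ifs \<Rightarrow> 'a ifs \<Rightarrow> 'a ifs" where
  "ifs_product S \<Gamma> m A B =
     ((\<lambda>a\<in>S. if factorizations S \<Gamma> m a = {} then 0
             else SUP (b, c)\<in>factorizations S \<Gamma> m a. min (membership A b) (membership B c)),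
      (\<lambda>a\<in>S. if factorizations S \<Gamma> m a = {} then 1
             else INF (b, c)\<in>factorizations S \<Gamma> m a. max (nonmembership A b) (nonmembership B c)))"

definition ifs_left_ideal ::
    "'a set \<Rightarrow> 'g set \<Rightarrow> ('a \<Rightarrow> 'g \<Rightarrow> 'a \<Rightarrow> 'a) \<Rightarrow> 'a ifs \<Rightarrow> bool" where
  "ifs_left_ideal S \<Gamma> m A \<longleftrightarrow> is_ifs S A \<and>
     (\<forall>x\<in>S. \<forall>y\<in>S. \<forall>\<alpha>\<in>\<Gamma>. membership A (m x \<alpha> y) \<ge> membership A y \<and>
                          nonmembership A (m x \<alpha> y) \<le> nonmembership A y)"

definition ifs_right_ideal ::
    "'a set \<Rightarrow> 'g set \<Rightarrow> ('a \<Rightarrow> 'g \<Rightarrow> 'a \<Rightarrow> 'a) \<Rightarrow> 'a ifs \<Rightarrow> bool" where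
  "ifs_right_ideal S \<Gamma> m A \<longleftrightarrow> is_ifs S A \<and>
     (\<forall>x\<in>S. \<forall>y\<in>S. \<forall>\<alpha>\<in>\<Gamma>. membership A (m x \<alpha> y) \<ge> membership A x \<and>
                          nonmembership A (m x \<alpha> y) \<le> nonmembership A x)"

definition ifs_two_sided_ideal ::
    "'a set \<Rightarrow> 'g set \<Rightarrow> ('a \<Rightarrow> 'g \<Rightarrow> 'a \<Rightarrow> 'a) \<Rightarrow> 'a ifs \<Rightarrow> bool" where
  "ifs_two_sided_ideal S \<Gamma> m A \<longleftrightarrow> ifs_left_ideal S \<Gamma> m A \<and> ifs_right_ideal S \<Gamma> m A"

definition ideal_structure ::
    "'a set \<Rightarrow> 'g set \<Rightarrow> ('a \<Rightarrow> 'g \<Rightarrow> 'a \<Rightarrow> 'a) \<Rightarrow> 'a ifs monoid" where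
  "ideal_structure S \<Gamma> m =
     \<lparr>carrier = {A. ifs_two_sided_ideal S \<Gamma> m A}, mult = ifs_product S \<Gamma> m, one = ifs_delta S\<rparr>"

text \<open>Algebraic semilattice with identity. Closure, associativity, commutativity and the
  identity laws on the carrier are part of \<^locale>\<open>comm_monoid\<close>; the locale
  \<open>semilattice_neutr\<close> of \<open>Main\<close> is not applicable since it has no carrier set.\<close>

locale semilattice_with_identity = comm_monoid L for L (structure) +
  assumes idempotent: "x \<in> carrier L \<Longrightarrow> x \<otimes> x = x"

end

(* Intra-regularity and the two groupoid laws rewrite a = (x(aa))y as a = (y(xa))a. On two-sided
   ideals every factorization of a bounds the product by the pointwise meet (min on memberships,
   max on nonmemberships), and this particular factorization attains the bound, so the product of
   ideals is their pointwise meet. *)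
theory Submission
  imports Defs
begin

text \<open>Restricting to \<open>S\<close> makes the meet extensional, like
  \<open>ifs_product\<close>, so the two can be compared by plain HOL equality.\<close>

definition ifs_meet :: "'a set \<Rightarrow> 'a ifs \<Rightarrow> 'a ifs \<Rightarrow> 'a ifs" where
  "ifs_meet S A B =
     ((\<lambda>a\<in>S. min (membership A a) (membership B a)),
      (\<lambda>a\<in>S. max (nonmembership A a) (nonmembership B a)))"

text \<open>The sum stays at most 1: whichever of \<open>A\<close>, \<open>B\<close> supplies the
  larger nonmembership, the smaller membership is at most its own membership.\<close>

lemma is_ifs_meet:
  assumes "is_ifs S A" and "is_ifs S B"
  shows "is_ifs S (ifs_meet S A B)"
  using assms unfolding is_ifs_def ifs_meet_def
  by (auto simp: PiE_iff min_def max_def dest!: bspec)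

lemma ifs_meet_commute: "ifs_meet S A B = ifs_meet S B A"
  by (simp add: ifs_meet_def min.commute max.commute)

lemma ifs_meet_assoc: "ifs_meet S (ifs_meet S A B) C = ifs_meet S A (ifs_meet S B C)"
  by (auto simp: ifs_meet_def min.assoc max.assoc fun_eq_iff)

lemma ifs_meet_idem:
  assumes "is_ifs S A"
  shows "ifs_meet S A A = A"
  using assms by (cases A) (auto simp: ifs_meet_def is_ifs_def PiE_iff extensional_restrict)

text \<open>The values 1 and 0 are neutral for \<open>min\<close> and \<open>max\<close> on the unit
  interval; extensionality of \<open>A\<close> settles the points outside \<open>S\<close>.\<close>

lemma ifs_meet_delta:
  assumes "is_ifs S A"
  shows "ifs_meet S (ifs_delta S) A = A"
proof -
  have "0 \<le> nonmembership A a \<and> membership A a \<le> 1" if "a \<in> S" for a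
    using assms that by (auto simp: is_ifs_def PiE_iff)
  moreover have "membership A \<in> extensional S" "nonmembership A \<in> extensional S"
    using assms by (auto simp: is_ifs_def PiE_iff)
  ultimately show ?thesis
    by (cases A) (auto simp: ifs_meet_def ifs_delta_def fun_eq_iff extensional_def restrict_def)
qed

context gamma_AG_groupoid
begin

lemma two_sided_ideal_meet:
  assumes "ifs_two_sided_ideal S \<Gamma> m A" and "ifs_two_sided_ideal S \<Gamma> m B"
  shows "ifs_two_sided_ideal S \<Gamma> m (ifs_meet S A B)"
proof -
  have "is_ifs S (ifs_meet S A B)"
    using assms
    by (simp add: is_ifs_meet ifs_two_sided_ideal_def ifs_left_ideal_def)
  then show ?thesis
    using assms unfolding ifs_two_sided_ideal_def ifs_left_ideal_def ifs_right_ideal_def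
    by (auto simp: ifs_meet_def m_mem
        intro: min.coboundedI1 min.coboundedI2 max.coboundedI1 max.coboundedI2)
qed

lemma two_sided_ideal_delta: "ifs_two_sided_ideal S \<Gamma> m (ifs_delta S)"
  unfolding ifs_two_sided_ideal_def ifs_left_ideal_def ifs_right_ideal_def
  by (auto simp: is_ifs_def ifs_delta_def m_mem)

end

context gamma_AG_star_star_groupoid
begin

text \<open>The gain is that the right factor is \<open>a\<close> itself, while the left factor
  arises from \<open>a\<close> by left multiplications only, which a left ideal controls.\<close>

lemma intra_regular_factorization:
  assumes "intra_regular S \<Gamma> m" and "a \<in> S"
  obtains x y \<alpha> \<beta> \<gamma> where "x \<in> S" "y \<in> S" "\<alpha> \<in> \<Gamma>" "\<beta> \<in> \<Gamma>" "\<gamma> \<in> \<Gamma>"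
    and "a = m (m y \<alpha> (m x \<beta> a)) \<gamma> a"
proof -
  obtain x y \<alpha> \<beta> \<gamma> where xy: "x \<in> S" "y \<in> S" "\<alpha> \<in> \<Gamma>" "\<beta> \<in> \<Gamma>" "\<gamma> \<in> \<Gamma>"
    and a: "a = m (m x \<alpha> (m a \<beta> a)) \<gamma> y"
    using assms unfolding intra_regular_def by blast
  note a
  also have "m (m x \<alpha> (m a \<beta> a)) \<gamma> y = m (m a \<alpha> (m x \<beta> a)) \<gamma> y"
    using xy \<open>a \<in> S\<close> by (simp add: star_star[of x a a])
  \<comment> \<open>The left invertive law exchanges the outer factors \<open>a\<close> and
    \<open>y\<close>.\<close>
  also have "\<dots> = m (m y \<alpha> (m x \<beta> a)) \<gamma> a"
    using xy \<open>a \<in> S\<close> by (intro left_invertive m_mem)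
  finally show ?thesis using that xy by blast
qed

lemma ifs_product_eq_meet:
  assumes intra: "intra_regular S \<Gamma> m"
    and A: "ifs_two_sided_ideal S \<Gamma> m A" and B: "ifs_two_sided_ideal S \<Gamma> m B"
  shows "ifs_product S \<Gamma> m A B = ifs_meet S A B"
proof -
  let ?F = "factorizations S \<Gamma> m"
  \<comment> \<open>Passing from a factor to the product \<open>a\<close> uses that \<open>A\<close>
    is a right ideal (for \<open>b\<close>) and \<open>B\<close> a left ideal (for
    \<open>c\<close>).\<close>
  have bounds: "min (membership A b) (membership B c) \<le> min (membership A a) (membership B a)"
      "max (nonmembership A a) (nonmembership B a) \<le> max (nonmembership A b) (nonmembership B c)"
    if "(b, c) \<in> ?F a" for a b c
    using that A B
    unfolding factorizations_def ifs_two_sided_ideal_def ifs_left_ideal_def ifs_right_ideal_def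
    by (auto intro: min.coboundedI1 min.coboundedI2 max.coboundedI1 max.coboundedI2)
  \<comment> \<open>Here \<open>A\<close> acts as a left ideal, applied twice along y(xa). Nothing
    about \<open>B\<close> enters, since the second factor is \<open>a\<close>.\<close>
  have attained: "\<exists>b. (b, a) \<in> ?F a \<and> membership A a \<le> membership A b
      \<and> nonmembership A b \<le> nonmembership A a" if aS: "a \<in> S" for a
  proof -
    obtain x y \<alpha> \<beta> \<gamma> where xy: "x \<in> S" "y \<in> S" "\<alpha> \<in> \<Gamma>" "\<beta> \<in> \<Gamma>" "\<gamma> \<in> \<Gamma>"
      and a: "a = m (m y \<alpha> (m x \<beta> a)) \<gamma> a"
      using intra_regular_factorization[OF intra aS] .
    have mem: "m x \<beta> a \<in> S" "m y \<alpha> (m x \<beta> a) \<in> S"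
      using xy aS by (auto intro: m_mem)
    have left: "membership A v \<le> membership A (m u \<delta> v)
        \<and> nonmembership A (m u \<delta> v) \<le> nonmembership A v"
      if "u \<in> S" "v \<in> S" "\<delta> \<in> \<Gamma>" for u v \<delta>
      using A that unfolding ifs_two_sided_ideal_def ifs_left_ideal_def by blast
    have "(m y \<alpha> (m x \<beta> a), a) \<in> ?F a"
      using a mem aS xy unfolding factorizations_def by blast
    moreover have "membership A a \<le> membership A (m y \<alpha> (m x \<beta> a))"
        "nonmembership A (m y \<alpha> (m x \<beta> a)) \<le> nonmembership A a"
      using left[of x a \<beta>] left[of y "m x \<beta> a" \<alpha>] xy aS mem by auto
    ultimately show ?thesis by blast
  qed
  \<comment> \<open>Nonemptiness rules out the default values 0 and 1 of the product.\<close>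
  have "?F a \<noteq> {}"
      "(SUP (b, c)\<in>?F a. min (membership A b) (membership B c)) = min (membership A a) (membership B a)"
      "(INF (b, c)\<in>?F a. max (nonmembership A b) (nonmembership B c)) =
        max (nonmembership A a) (nonmembership B a)"
    if a: "a \<in> S" for a
  proof -
    obtain b where b: "(b, a) \<in> ?F a"
      and le: "membership A a \<le> membership A b" "nonmembership A b \<le> nonmembership A a"
      using attained[OF a] by blast
    show "?F a \<noteq> {}" using b by blast
    \<comment> \<open>One inequality is the general bound, the other comes from \<open>le\<close>;
      so the bound is itself a member of the set, and the supremum is a maximum.\<close>
    have "min (membership A b) (membership B a) = min (membership A a) (membership B a)"
      using bounds(1)[OF b] le by linarith
    then show "(SUP (b, c)\<in>?F a. min (membership A b) (membership B c)) =
        min (membership A a) (membership B a)"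
      using b bounds(1) by (intro cSup_eq_maximum) (auto intro!: image_eqI[where x = "(b, a)"])
    have "max (nonmembership A b) (nonmembership B a) = max (nonmembership A a) (nonmembership B a)"
      using bounds(2)[OF b] le by linarith
    then show "(INF (b, c)\<in>?F a. max (nonmembership A b) (nonmembership B c)) =
        max (nonmembership A a) (nonmembership B a)"
      using b bounds(2) by (intro cInf_eq_minimum) (auto intro!: image_eqI[where x = "(b, a)"])
  qed
  then show ?thesis
    unfolding ifs_product_def ifs_meet_def by (auto intro!: restrict_ext)
qed

end

theorem theorem8:
  fixes S :: "'a set" and \<Gamma> :: "'g set" and m :: "'a \<Rightarrow> 'g \<Rightarrow> 'a \<Rightarrow> 'a"
  assumes "gamma_AG_star_star_groupoid S \<Gamma> m"
    and "intra_regular S \<Gamma> m"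
  shows "semilattice_with_identity (ideal_structure S \<Gamma> m)"
proof -
  interpret gamma_AG_star_star_groupoid S \<Gamma> m by fact
  let ?L = "ideal_structure S \<Gamma> m"
  have carrier: "A \<in> carrier ?L \<longleftrightarrow> ifs_two_sided_ideal S \<Gamma> m A" for A
    by (simp add: ideal_structure_def)
  have one: "\<one>\<^bsub>?L\<^esub> = ifs_delta S"
    by (simp add: ideal_structure_def)
  \<comment> \<open>This rewriting is available for ideals only, so nested products also need
    \<open>closed\<close>.\<close>
  have mult: "A \<otimes>\<^bsub>?L\<^esub> B = ifs_meet S A B" if "A \<in> carrier ?L" "B \<in> carrier ?L" for A B
    using that ifs_product_eq_meet[OF assms(2)] by (simp add: ideal_structure_def)
  have closed: "ifs_meet S A B \<in> carrier ?L" if "A \<in> carrier ?L" "B \<in> carrier ?L" for A B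
    using that by (simp add: carrier two_sided_ideal_meet)
  have delta: "ifs_delta S \<in> carrier ?L"
    by (simp add: carrier two_sided_ideal_delta)
  have ifs: "is_ifs S A" if "A \<in> carrier ?L" for A
    using that by (simp add: carrier ifs_two_sided_ideal_def ifs_left_ideal_def)
  \<comment> \<open>\<open>comm_monoidI\<close> asks only for the left identity law. Commutativity
    is the goal left to the final rule.\<close>
  have "comm_monoid ?L"
    by (rule comm_monoidI)
      (simp_all add: one mult closed delta ifs ifs_meet_assoc ifs_meet_delta, rule ifs_meet_commute)
  moreover have "A \<otimes>\<^bsub>?L\<^esub> A = A" if "A \<in> carrier ?L" for A
    using that by (simp add: mult ifs ifs_meet_idem)
  ultimately show ?thesis
    by (simp add: semilattice_with_identity_def semilattice_with_identity_axioms_def)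
qed

end
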